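(* Let $X$ be a compact metric space and let $f:X\to X$ be a continuous map. Then $f$ has shadowing if and only if there exist an inverse sequence of shifts of finite type, with inverse limit system $(\sigma^*,Y)$, and a semiconjugacy $\phi:(\sigma^*,Y)\to(f,X)$ which almost lifts pseudo-orbits.
   Context: $\omega=\{0,1,2,\dots\}$; all maps are continuous. A dynamical system $(f,X)$ is a continuous map $f:X\to X$. Shadowing. For $f:X\to X$ on a compact metric space $(X,d)$, a sequence $\langle x_i\rangle_{i\in\omega}$ is a $\delta$-pseudo-orbit if $d(x_{i+1},f(x_i))<\delta$ for all $i\in\omega$; a point $z$ $\epsilon$-shadows $\langle x_i\rangle$ if $d(x_i,f^i(z))<\epsilon$ for all $i\in\omega$. The map $f$ has shadowing if for every $\epsilon>0$ there is $\delta>0$ such that every $\delta$-pseudo-orbit is $\epsilon$-shadowed by some point of $X$. Shifts of finite type. For a finite set $\Sigma$ (with the discrete topology), $\Sigma^\omega$ carries the product topology and the shift map $\sigma\langle x_i\rangle=\langle x_{i+1}\rangle$. A shift space is a compact $\sigma$-invariant subset of some $\Sigma^\omega$. A shift space $Z$ is a shift of finite type over $\Sigma$ if there is a finite collection $\mathcal F$ of finite words in $\Sigma$ such that $\langle x_i\rangle\in\Sigma^\omega$ belongs to $Z$ if and only if $x_ix_{i+1}\cdots x_j\notin\mathcal F$ for all $i\le j$. It is regarded as the dynamical system $(\sigma,Z)$. Inverse limits. An inverse sequence of dynamical systems consists of systems $(f_n,X_n)$, $n\in\omega$, on compact Hausdorff spaces and continuous surjections $g_n^m:X_m\to X_n$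 for $n\le m$ with $g_n^n=\mathrm{id}$, $g_n^k=g_n^m\circ g_m^k$ for $n\le m\le k$, and $f_n\circ g_n^m=g_n^m\circ f_m$ for $n\le m$. Its inverse limit is the dynamical system on $\{\langle x_n\rangle\in\prod X_n: x_n=g_n^m(x_m)\ \forall n\le m\}$ (subspace of the product) with the induced map $\langle x_n\rangle\mapsto\langle f_n(x_n)\rangle$; for shifts of finite type (all $f_n=\sigma$) this induced map is denoted $\sigma^*$. An inverse limit of a sequence of shifts of finite type is a compact metrizable space; fix any compatible metric on it. Semiconjugacy. A semiconjugacy (factor map) $\phi:(g,Y)\to(f,X)$ is a continuous surjection $\phi:Y\to X$ with $\phi\circ g=f\circ\phi$. Almost lifting pseudo-orbits. A semiconjugacy $\phi:(g,Y)\to(f,X)$ of compact metric systems almost lifts pseudo-orbits (is an ALP map) if for all $\epsilon>0$ and $\eta>0$ there is $\delta>0$ such that for every $\delta$-pseudo-orbit $\langle x_i\rangle$ in $X$ (for $f$) there is an $\eta$-pseudo-orbit $\langle y_i\rangle$ in $Y$ (for $g$) with $d(\phi(y_i),x_i)<\epsilon$ for all $i\in\omega$. *)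

theory Defs
  imports "HOL-Analysis.Analysis"
begin

definition dynamical_system :: "('a::topological_space \<Rightarrow> 'a) \<Rightarrow> 'a set \<Rightarrow> bool" where
  "dynamical_system f X \<longleftrightarrow> continuous_on X f \<and> f ` X \<subseteq> X"

definition semiconjugacy ::
    "('b::topological_space \<Rightarrow> 'b) \<Rightarrow> 'b set \<Rightarrow> ('a::topological_space \<Rightarrow> 'a) \<Rightarrow> 'a set \<Rightarrow> ('b \<Rightarrow> 'a) \<Rightarrow> bool" where
  "semiconjugacy g Y f X \<phi> \<longleftrightarrow>
     continuous_on Y \<phi> \<and> \<phi> ` Y = X \<and> (\<forall>y\<in>Y. \<phi> (g y) = f (\<phi> y))"


section \<open>Pseudo-orbits, shadowing and ALP maps\<close>

text \<open>
  The metric is an explicit argument because the type of an inverse limit of shift spaces,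
  \<^typ>\<open>nat \<Rightarrow> nat \<Rightarrow> nat\<close>, has a topology but no \<^const>\<open>dist\<close>.
\<close>

definition pseudo_orbit ::
    "('a \<Rightarrow> 'a) \<Rightarrow> 'a set \<Rightarrow> ('a \<Rightarrow> 'a \<Rightarrow> real) \<Rightarrow> real \<Rightarrow> (nat \<Rightarrow> 'a) \<Rightarrow> bool" where
  "pseudo_orbit f X d \<delta> x \<longleftrightarrow> (\<forall>i. x i \<in> X) \<and> (\<forall>i. d (x (Suc i)) (f (x i)) < \<delta>)"

definition shadows ::
    "('a \<Rightarrow> 'a) \<Rightarrow> ('a \<Rightarrow> 'a \<Rightarrow> real) \<Rightarrow> real \<Rightarrow> 'a \<Rightarrow> (nat \<Rightarrow> 'a) \<Rightarrow> bool" where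
  "shadows f d \<epsilon> z x \<longleftrightarrow> (\<forall>i. d (x i) ((f ^^ i) z) < \<epsilon>)"

definition has_shadowing :: "('a \<Rightarrow> 'a) \<Rightarrow> 'a set \<Rightarrow> ('a \<Rightarrow> 'a \<Rightarrow> real) \<Rightarrow> bool" where
  "has_shadowing f X d \<longleftrightarrow>
     (\<forall>\<epsilon>>0. \<exists>\<delta>>0. \<forall>x. pseudo_orbit f X d \<delta> x \<longrightarrow> (\<exists>z\<in>X. shadows f d \<epsilon> z x))"

definition almost_lifts_pseudo_orbits ::
    "('b \<Rightarrow> 'b) \<Rightarrow> 'b set \<Rightarrow> ('b \<Rightarrow> 'b \<Rightarrow> real) \<Rightarrow>
     ('a \<Rightarrow> 'a) \<Rightarrow> 'a set \<Rightarrow> ('a \<Rightarrow> 'a \<Rightarrow> real) \<Rightarrow> ('b \<Rightarrow> 'a) \<Rightarrow> bool" where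
  "almost_lifts_pseudo_orbits g Y d\<^sub>Y f X d\<^sub>X \<phi> \<longleftrightarrow>
     (\<forall>\<epsilon>>0. \<forall>\<eta>>0. \<exists>\<delta>>0. \<forall>x. pseudo_orbit f X d\<^sub>X \<delta> x \<longrightarrow>
        (\<exists>y. pseudo_orbit g Y d\<^sub>Y \<eta> y \<and> (\<forall>i. d\<^sub>X (\<phi> (y i)) (x i) < \<epsilon>)))"

definition compatible_metric :: "'a::topological_space set \<Rightarrow> ('a \<Rightarrow> 'a \<Rightarrow> real) \<Rightarrow> bool" where
  "compatible_metric Y d \<longleftrightarrow> Metric_space Y d \<and> Metric_space.mtopology Y d = top_of_set Y"


section \<open>Shifts of finite type\<close>

text \<open>
  Alphabets are finite sets of natural numbers; every finite set is in bijection with one of these.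
  The type \<^typ>\<open>nat\<close> carries the discrete topology and \<^typ>\<open>nat \<Rightarrow> nat\<close> the product
  topology.
\<close>

definition shift_map :: "(nat \<Rightarrow> 'a) \<Rightarrow> nat \<Rightarrow> 'a" where
  "shift_map x = (\<lambda>i. x (Suc i))"

definition shift_space :: "nat set \<Rightarrow> (nat \<Rightarrow> nat) set \<Rightarrow> bool" where
  "shift_space \<Sigma> Z \<longleftrightarrow> finite \<Sigma> \<and> Z \<subseteq> (UNIV \<rightarrow> \<Sigma>) \<and> compact Z \<and> shift_map ` Z \<subseteq> Z"

definition sft_over :: "nat set \<Rightarrow> (nat \<Rightarrow> nat) set \<Rightarrow> bool" where
  "sft_over \<Sigma> Z \<longleftrightarrow> shift_space \<Sigma> Z \<and>
     (\<exists>\<F>. finite \<F> \<and> \<F> \<subseteq> lists \<Sigma> \<and>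
       (\<forall>x\<in>UNIV \<rightarrow> \<Sigma>. x \<in> Z \<longleftrightarrow> (\<forall>i j. i \<le> j \<longrightarrow> map x [i..<Suc j] \<notin> \<F>)))"


section \<open>Inverse sequences and inverse limits\<close>

text \<open>The bonding map \<^term>\<open>g n m\<close> goes from \<^term>\<open>X m\<close> to \<^term>\<open>X n\<close>, for \<^prop>\<open>n \<le> m\<close>.\<close>

definition inverse_sequence ::
    "(nat \<Rightarrow> 'a::topological_space \<Rightarrow> 'a) \<Rightarrow> (nat \<Rightarrow> 'a set) \<Rightarrow> (nat \<Rightarrow> nat \<Rightarrow> 'a \<Rightarrow> 'a) \<Rightarrow> bool" where
  "inverse_sequence f X g \<longleftrightarrow>
     (\<forall>n. compact (X n) \<and> Hausdorff_space (top_of_set (X n)) \<and> dynamical_system (f n) (X n)) \<and>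
     (\<forall>n m. n \<le> m \<longrightarrow> continuous_on (X m) (g n m) \<and> g n m ` X m = X n) \<and>
     (\<forall>n. \<forall>x\<in>X n. g n n x = x) \<and>
     (\<forall>n m k. n \<le> m \<longrightarrow> m \<le> k \<longrightarrow> (\<forall>x\<in>X k. g n k x = g n m (g m k x))) \<and>
     (\<forall>n m. n \<le> m \<longrightarrow> (\<forall>x\<in>X m. f n (g n m x) = g n m (f m x)))"

definition inverse_limit :: "(nat \<Rightarrow> 'a set) \<Rightarrow> (nat \<Rightarrow> nat \<Rightarrow> 'a \<Rightarrow> 'a) \<Rightarrow> (nat \<Rightarrow> 'a) set" where
  "inverse_limit X g = {x. (\<forall>n. x n \<in> X n) \<and> (\<forall>n m. n \<le> m \<longrightarrow> x n = g n m (x m))}"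

definition induced_map :: "(nat \<Rightarrow> 'a \<Rightarrow> 'a) \<Rightarrow> (nat \<Rightarrow> 'a) \<Rightarrow> nat \<Rightarrow> 'a" where
  "induced_map f x = (\<lambda>n. f n (x n))"

definition sft_inverse_sequence ::
    "(nat \<Rightarrow> (nat \<Rightarrow> nat) set) \<Rightarrow> (nat \<Rightarrow> nat \<Rightarrow> (nat \<Rightarrow> nat) \<Rightarrow> (nat \<Rightarrow> nat)) \<Rightarrow> bool" where
  "sft_inverse_sequence Z g \<longleftrightarrow>
     (\<forall>n. \<exists>\<Sigma>. sft_over \<Sigma> (Z n)) \<and> inverse_sequence (\<lambda>n. shift_map) Z g"

definition shift_star :: "(nat \<Rightarrow> nat \<Rightarrow> nat) \<Rightarrow> nat \<Rightarrow> nat \<Rightarrow> nat" where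
  "shift_star = induced_map (\<lambda>n. shift_map)"


section \<open>Inverse limits of shift spaces are metrizable\<close>

lemma euclidean_nat_nat_nat:
  "(euclidean :: (nat \<Rightarrow> nat \<Rightarrow> nat) topology) =
     product_topology (\<lambda>_. product_topology (\<lambda>_. discrete_topology UNIV) UNIV) UNIV"
proof -
  have d: "(euclidean :: nat topology) = discrete_topology UNIV"
    by (rule topology_eq[THEN iffD2]) (simp add: open_discrete)
  have "(euclidean :: (nat \<Rightarrow> nat) topology) = product_topology (\<lambda>_. discrete_topology UNIV) UNIV"
    using euclidean_product_topology[where 'a=nat and 'b=nat] d by metis
  then show ?thesis
    using euclidean_product_topology[where 'a=nat and 'b="nat \<Rightarrow> nat"] by metis
qed

lemma compatible_metric_exists:
  fixes Y :: "(nat \<Rightarrow> nat \<Rightarrow> nat) set"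
  shows "\<exists>d. compatible_metric Y d"
proof -
  have "metrizable_space (top_of_set Y)"
    unfolding euclidean_nat_nat_nat
    by (intro metrizable_space_subtopology)
       (auto simp: metrizable_space_product_topology intro: countable_subset)
  then show ?thesis
    unfolding metrizable_space_def compatible_metric_def
    by (metis Metric_space.topspace_mtopology topspace_euclidean_subtopology)
qed

end

theory Submission
  imports Defs
begin

text \<open>
  If \<open>Y\<close> is an inverse limit of shifts of finite type with surjective bonding maps, then a fine
  pseudo-orbit of \<open>Y\<close> projects to a fine pseudo-orbit of a single level \<open>Z\<^sub>N\<close>, which is shadowed
  there; the shadowing point lifts to \<open>Y\<close>.  Shadowing then descends along an ALP map.

  Conversely, let \<open>f\<close> have shadowing.  Choose \<open>\<delta>\<^sub>n\<close> for \<open>\<epsilon> = 2\<^sup>-\<^sup>n\<close> and a finite net of \<open>X\<close> so fine that every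
  orbit is traced by a \<open>\<delta>\<^sub>n\<close>-pseudo-orbit in the net.  Let \<open>Z\<^sub>n\<close> be the set of stacks \<open>(p\<^sup>0, \<dots>, p\<^sup>n)\<close> where
  \<open>p\<^sup>k\<close> is a \<open>\<delta>\<^sub>k\<close>-pseudo-orbit in the \<open>k\<close>-th net and consecutive pseudo-orbits are \<open>2 / 2\<^sup>k\<close>-close.  This
  is a shift of finite type, and truncation \<open>Z\<^sub>n\<^sub>+\<^sub>1 \<rightarrow> Z\<^sub>n\<close> is surjective: shadow \<open>p\<^sup>n\<close> by a true orbit and
  trace that orbit in the next net.  Sending a stack to the limit of the points \<open>p\<^sup>k(0)\<close> is a
  semiconjugacy onto \<open>X\<close>.  Any semiconjugacy onto a system with shadowing is ALP, because a
  shadowing orbit lifts to a true orbit.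
\<close>

section \<open>Compactness and discrete coordinates\<close>

lemma continuous_on_coordinate: "continuous_on S (\<lambda>x. x i)"
  by (rule continuous_on_subset[OF continuous_on_product_coordinates]) simp

text \<open>A continuous map into a discrete space is locally constant, so \<open>h\<close> may be
  arbitrary. With \<open>h\<close> a relation, conditions on two letters become continuous
  predicates.\<close>

lemma continuous_on_discrete2:
  fixes u :: "'a::topological_space \<Rightarrow> 'b::discrete_topology"
    and v :: "'a \<Rightarrow> 'c::discrete_topology" and h :: "'b \<Rightarrow> 'c \<Rightarrow> 'd::topological_space"
  assumes "continuous_on S u" "continuous_on S v"
  shows "continuous_on S (\<lambda>x. h (u x) (v x))"
  unfolding continuous_on_topological
proof (intro ballI allI impI)
  fix x B assume x: "x \<in> S" and "open B" "h (u x) (v x) \<in> B"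
  obtain A1 where "open A1" "x \<in> A1" "\<forall>y\<in>S. y \<in> A1 \<longrightarrow> u y \<in> {u x}"
    using assms(1) x unfolding continuous_on_topological by (metis open_discrete singletonI)
  moreover obtain A2 where "open A2" "x \<in> A2" "\<forall>y\<in>S. y \<in> A2 \<longrightarrow> v y \<in> {v x}"
    using assms(2) x unfolding continuous_on_topological by (metis open_discrete singletonI)
  ultimately show "\<exists>A. open A \<and> x \<in> A \<and> (\<forall>y\<in>S. y \<in> A \<longrightarrow> h (u y) (v y) \<in> B)"
    using \<open>h (u x) (v x) \<in> B\<close> by (intro exI[of _ "A1 \<inter> A2"]) auto
qed

lemma continuous_on_discrete1:
  fixes u :: "'a::topological_space \<Rightarrow> 'b::discrete_topology"
  assumes "continuous_on S u"
  shows "continuous_on S (\<lambda>x. h (u x))"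
  using continuous_on_discrete2[OF assms assms, of "\<lambda>a b. h a"] .

text \<open>A continuous predicate is true on a relatively closed set, and intersections of such
  sets in a compact space are compact.\<close>

lemma compact_Collect_discrete:
  fixes P :: "'i \<Rightarrow> 'a::topological_space \<Rightarrow> bool"
  assumes "compact S" "\<And>i. continuous_on S (P i)"
  shows "compact {x \<in> S. \<forall>i. P i x}"
proof -
  have "closedin (top_of_set S) (\<Inter>i. {x \<in> S. P i x})"
  proof (rule closedin_INT)
    show "closedin (top_of_set S) {x \<in> S. P i x}" for i
      using continuous_closedin_preimage_constant[OF assms(2)[of i], of True] by simp
  qed auto
  moreover have "(\<Inter>i. {x \<in> S. P i x}) = {x \<in> S. \<forall>i. P i x}" by auto
  ultimately show ?thesis using closedin_compact[OF assms(1)] by metis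
qed

text \<open>Tychonoff's theorem, transferred from the abstract product topology to the function
  type.\<close>

lemma compact_PiE_UNIV:
  fixes A :: "'i \<Rightarrow> 'a::topological_space set"
  assumes "\<And>i. compact (A i)"
  shows "compact {x. \<forall>i. x i \<in> A i}"
proof -
  have "compactin (product_topology (\<lambda>i. euclidean) UNIV) (PiE UNIV A)"
    using assms by (simp add: compactin_PiE)
  moreover have "PiE UNIV A = {x. \<forall>i. x i \<in> A i}" by auto
  ultimately show ?thesis by (metis compactin_euclidean_iff euclidean_product_topology)
qed

lemma Hausdorff_space_nat_seq: "Hausdorff_space (top_of_set (Z :: (nat \<Rightarrow> nat) set))"
proof -
  have "Hausdorff_space (euclidean :: nat topology)"
    unfolding Hausdorff_space_def
  proof (intro allI impI)
    fix x y :: nat assume "x \<in> topspace euclidean \<and> y \<in> topspace euclidean \<and> x \<noteq> y"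
    then show "\<exists>U V. openin euclidean U \<and> openin euclidean V \<and> x \<in> U \<and> y \<in> V \<and> disjnt U V"
      by (intro exI[of _ "{x}"] exI[of _ "{y}"]) (simp add: open_discrete)
  qed
  then have "Hausdorff_space (product_topology (\<lambda>_::nat. euclidean :: nat topology) UNIV)"
    unfolding Hausdorff_space_product_topology by blast
  then have "Hausdorff_space (euclidean :: (nat \<Rightarrow> nat) topology)"
    unfolding euclidean_product_topology .
  then show ?thesis by (rule Hausdorff_space_subtopology)
qed

lemma continuous_on_coordinate2:
  fixes S :: "(nat \<Rightarrow> nat \<Rightarrow> nat) set"
  shows "continuous_on S (\<lambda>y. y n i)"
  by (rule continuous_on_product_then_coordinatewise[OF continuous_on_coordinate])

section \<open>Shifts of finite type and their inverse limits\<close>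

text \<open>The forbidden words are the two-letter words violating \<open>R\<close>. The stacks
  below are brought into this form.\<close>

lemma sft_over_one_step:
  assumes "finite \<Sigma>"
  shows "sft_over \<Sigma> {x. (\<forall>i. x i \<in> \<Sigma>) \<and> (\<forall>i. R (x i) (x (Suc i)))}" (is "sft_over _ ?Z")
proof -
  have "compact {x \<in> {x. \<forall>i. x i \<in> \<Sigma>}. \<forall>i. R (x i) (x (Suc i))}"
    by (rule compact_Collect_discrete, rule compact_PiE_UNIV, rule finite_imp_compact[OF assms],
        rule continuous_on_discrete2) (rule continuous_on_coordinate)+
  then have "shift_space \<Sigma> ?Z"
    using assms by (auto simp: shift_space_def shift_map_def)
  moreover define F where "F = {[a, b] |a b. a \<in> \<Sigma> \<and> b \<in> \<Sigma> \<and> \<not> R a b}"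
  have "F \<subseteq> (\<lambda>(a,b). [a,b]) ` (\<Sigma> \<times> \<Sigma>)" by (auto simp: F_def)
  then have "finite F" using assms by (meson finite_SigmaI finite_imageI finite_subset)
  moreover have "F \<subseteq> lists \<Sigma>" by (auto simp: F_def)
  moreover have "x \<in> ?Z \<longleftrightarrow> (\<forall>i j. i \<le> j \<longrightarrow> map x [i..<Suc j] \<notin> F)" if x: "x \<in> UNIV \<rightarrow> \<Sigma>" for x
  proof
    assume z: "x \<in> ?Z"
    show "\<forall>i j. i \<le> j \<longrightarrow> map x [i..<Suc j] \<notin> F"
    proof (intro allI impI notI)
      fix i j assume "i \<le> j" and w: "map x [i..<Suc j] \<in> F"
      from w obtain a b where ab: "map x [i..<Suc j] = [a, b]" "\<not> R a b"
        unfolding F_def mem_Collect_eq by (elim exE conjE) (rule that)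
      \<comment> \<open>A forbidden word has two letters, so the window consists of the positions
        \<open>i\<close> and \<open>Suc i\<close>.\<close>
      then have "Suc j - i = 2" using length_map[of x "[i..<Suc j]"] by (simp del: upt_Suc)
      then have j: "j = Suc i" using \<open>i \<le> j\<close> by simp
      have "map x [i..<Suc j] = [x i, x (Suc i)]" by (simp add: j)
      then show False using ab z by auto
    qed
  next
    assume *: "\<forall>i j. i \<le> j \<longrightarrow> map x [i..<Suc j] \<notin> F"
    have "R (x i) (x (Suc i))" for i
    proof -
      have "map x [i..<Suc (Suc i)] = [x i, x (Suc i)]" by simp
      then show ?thesis using *[rule_format, of i "Suc i"] x by (auto simp: F_def simp del: upt_Suc)
    qed
    then show "x \<in> ?Z" using x by auto
  qed
  ultimately show ?thesis unfolding sft_over_def by (intro conjI exI[of _ F] ballI)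
qed

text \<open>Let \<open>L\<close> bound the lengths of the forbidden words. The hypothesis on
  \<open>x\<close> is the pseudo-orbit condition read on the coordinates up to \<open>M\<close>. It
  makes every window of length at most \<open>L\<close> in the sequence of first letters occur
  inside some \<open>x i\<close>, so that sequence contains no forbidden word.\<close>

lemma sft_shadowing:
  assumes "sft_over \<Sigma> Z"
  obtains L where "\<And>M x. \<lbrakk>L \<le> M; \<And>j. x j \<in> Z; \<And>i j. i \<le> M \<Longrightarrow> x (Suc j) i = x j (Suc i)\<rbrakk>
      \<Longrightarrow> \<exists>z\<in>Z. \<forall>j. \<forall>i\<le>M. (shift_map ^^ j) z i = x j i"
proof -
  obtain F where F: "finite F" "\<And>x. x \<in> UNIV \<rightarrow> \<Sigma> \<Longrightarrow> x \<in> Z \<longleftrightarrow> (\<forall>i j. i \<le> j \<longrightarrow> map x [i..<Suc j] \<notin> F)"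
    and ZS: "Z \<subseteq> UNIV \<rightarrow> \<Sigma>"
    using assms unfolding sft_over_def shift_space_def by auto
  have "finite (length ` F)" using F by auto
  then obtain L where L: "\<And>w. w \<in> F \<Longrightarrow> length w \<le> L"
    by (meson finite_nat_set_iff_bounded_le imageI)
  show ?thesis
  proof (rule that[of L])
    fix M and x :: "nat \<Rightarrow> nat \<Rightarrow> nat"
    assume "L \<le> M" and xZ: "\<And>j. x j \<in> Z" and x: "\<And>i j. i \<le> M \<Longrightarrow> x (Suc j) i = x j (Suc i)"
    define z where "z j = x j 0" for j
    \<comment> \<open>Each use of the hypothesis trades one coordinate for one time step, until
      coordinate 0 is reached.\<close>
    have xz: "x j i = z (j + i)" if "i \<le> M" for i j
      using that by (induction i arbitrary: j) (auto simp: z_def simp flip: x)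
    have "map z [i..<Suc j] \<notin> F" if "i \<le> j" for i j
    proof
      assume w: "map z [i..<Suc j] \<in> F"
      then have "Suc j - i \<le> L" using L[OF w] by (simp del: upt_Suc)
      then have "map (x i) [0..<Suc (j - i)] = map z [i..<Suc j]"
        using \<open>L \<le> M\<close> \<open>i \<le> j\<close> by (intro nth_equalityI) (auto simp: xz simp del: upt_Suc)
      then show False using w F(2)[of "x i"] xZ[of i] ZS by (metis le0 subsetD)
    qed
    moreover have "z \<in> UNIV \<rightarrow> \<Sigma>" using xZ ZS unfolding z_def by fastforce
    ultimately have "z \<in> Z" using F(2) by blast
    moreover have "(shift_map ^^ j) z i = z (j + i)" for i j
      by (induction j arbitrary: i) (auto simp: shift_map_def)
    ultimately show "\<exists>z\<in>Z. \<forall>j. \<forall>i\<le>M. (shift_map ^^ j) z i = x j i"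
      using xz by metis
  qed
qed

section \<open>Inverse limits: compactness and surjective projections\<close>

lemma inverse_sequenceD:
  assumes "inverse_sequence f X g"
  shows "compact (X n)"
    and "n \<le> m \<Longrightarrow> continuous_on (X m) (g n m)"
    and "n \<le> m \<Longrightarrow> g n m ` X m = X n"
    and "x \<in> X n \<Longrightarrow> g n n x = x"
    and "\<lbrakk>n \<le> m; m \<le> k; x \<in> X k\<rbrakk> \<Longrightarrow> g n k x = g n m (g m k x)"
    and "\<lbrakk>n \<le> m; x \<in> X m\<rbrakk> \<Longrightarrow> f n (g n m x) = g n m (f m x)"
    and "f n ` X n \<subseteq> X n"
proof -
  note * = assms[unfolded inverse_sequence_def dynamical_system_def]
  note 1 = *[THEN conjunct1, rule_format]
  note 2 = *[THEN conjunct2]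
  note 3 = 2[THEN conjunct2]
  show "compact (X n)" "f n ` X n \<subseteq> X n" using 1 by simp_all
  show "n \<le> m \<Longrightarrow> continuous_on (X m) (g n m)" "n \<le> m \<Longrightarrow> g n m ` X m = X n"
    using 2[THEN conjunct1, rule_format] by simp_all
  show "x \<in> X n \<Longrightarrow> g n n x = x" using 3[THEN conjunct1] by simp
  show "\<lbrakk>n \<le> m; m \<le> k; x \<in> X k\<rbrakk> \<Longrightarrow> g n k x = g n m (g m k x)"
    by (rule 3[THEN conjunct2, THEN conjunct1, rule_format])
  show "\<lbrakk>n \<le> m; x \<in> X m\<rbrakk> \<Longrightarrow> f n (g n m x) = g n m (f m x)"
    by (rule 3[THEN conjunct2, THEN conjunct2, rule_format])
qed

text \<open>Read coordinate by coordinate, a bonding equation compares two natural numbers that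
  depend continuously on the point. Hence these equations cut a closed set out of the compact
  product.\<close>

lemma compact_inverse_limit:
  fixes X :: "nat \<Rightarrow> (nat \<Rightarrow> nat) set"
  assumes "inverse_sequence f X g"
  shows "compact (inverse_limit X g)"
proof -
  let ?P = "{x. \<forall>n. x n \<in> X n}"
  have "compact {x \<in> ?P. \<forall>p::nat \<times> nat \<times> nat. case p of (n, m, i) \<Rightarrow> n \<le> m \<longrightarrow> x n i = g n m (x m) i}"
  proof (rule compact_Collect_discrete, rule compact_PiE_UNIV)
    show "compact (X i)" for i by (rule inverse_sequenceD[OF assms])
    have "continuous_on ?P (\<lambda>x. x n i = g n m (x m) i)" if "n \<le> m" for n m i
    proof (rule continuous_on_discrete2[where h = "(=)"])
      have "continuous_on (X m) (\<lambda>z. g n m z i)"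
        by (rule continuous_on_product_then_coordinatewise[OF inverse_sequenceD(2)[OF assms that]])
      then show "continuous_on ?P (\<lambda>x. g n m (x m) i)"
        by (rule continuous_on_compose2[where f = "\<lambda>x. x m"])
          (auto intro: continuous_on_coordinate)
    qed (rule continuous_on_coordinate2)
    then have "continuous_on ?P (\<lambda>x. n \<le> m \<longrightarrow> x n i = g n m (x m) i)" for n m i
      by (cases "n \<le> m") auto
    then show "continuous_on ?P (\<lambda>x. case p of (n, m, i) \<Rightarrow> n \<le> m \<longrightarrow> x n i = g n m (x m) i)"
      for p :: "nat \<times> nat \<times> nat" by (cases p) auto
  qed
  moreover have "{x \<in> ?P. \<forall>p::nat \<times> nat \<times> nat. case p of (n, m, i) \<Rightarrow> n \<le> m \<longrightarrow> x n i = g n m (x m) i}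
      = inverse_limit X g"
    by (auto simp: inverse_limit_def fun_eq_iff)
  ultimately show ?thesis by simp
qed

text \<open>Starting from \<open>z\<close>, preimages under the surjective bonding maps are chosen
  level by level above \<open>N\<close>; the levels below are images.\<close>

lemma inverse_limit_projection_surj:
  assumes "inverse_sequence f X g" "z \<in> X N"
  obtains y where "y \<in> inverse_limit X g" "y N = z"
proof -
  note surj = inverse_sequenceD(3)[OF assms(1)]
    and id = inverse_sequenceD(4)[OF assms(1)]
    and comp = inverse_sequenceD(5)[OF assms(1)]
  have "\<exists>w. \<forall>k. (w k \<in> X (N + k) \<and> (k = 0 \<longrightarrow> w k = z)) \<and> g (N + k) (N + Suc k) (w (Suc k)) = w k"
  proof (rule dependent_nat_choice)
    fix v k assume "v \<in> X (N + k) \<and> (k = 0 \<longrightarrow> v = z)"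
    then have "v \<in> g (N + k) (N + Suc k) ` X (N + Suc k)" using surj by simp
    then show "\<exists>u. (u \<in> X (N + Suc k) \<and> (Suc k = 0 \<longrightarrow> u = z)) \<and> g (N + k) (N + Suc k) u = v"
      by blast
  qed (use assms(2) in auto)
  then obtain w where w: "\<And>k. w k \<in> X (N + k)" "w 0 = z"
    and gstep: "\<And>k. g (N + k) (N + Suc k) (w (Suc k)) = w k" by auto
  have gw: "g (N + j) (N + k) (w k) = w j" if "j \<le> k" for j k
    using that
  proof (induction k rule: dec_induct)
    case (step k)
    have "g (N + j) (N + Suc k) (w (Suc k)) = g (N + j) (N + k) (g (N + k) (N + Suc k) (w (Suc k)))"
      by (rule comp) (use step.hyps w(1)[of "Suc k"] in auto)
    then show ?case using gstep step.IH by simp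
  qed (simp add: id w)
  \<comment> \<open>Since \<open>w n\<close> sits at level \<open>N + n\<close>, at least
    \<open>n\<close>, one formula covers the levels below and above \<open>N\<close>.\<close>
  define y where "y n = g n (N + n) (w n)" for n
  have "y n \<in> X n" for n using surj[of n "N + n"] w(1)[of n] by (auto simp: y_def)
  moreover have "y n = g n m (y m)" if "n \<le> m" for n m
  proof -
    have "g n m (y m) = g n (N + m) (w m)"
      using comp[of n m "N + m" "w m"] that w by (simp add: y_def)
    also have "\<dots> = y n"
      using comp[of n "N + n" "N + m" "w m"] that w gw[OF that] by (simp add: y_def)
    finally show ?thesis by simp
  qed
  ultimately have "y \<in> inverse_limit X g" by (auto simp: inverse_limit_def)
  moreover have "y N = z" using gw[of 0 N] w by (simp add: y_def)
  ultimately show ?thesis using that by blast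
qed

section \<open>Compatible metrics\<close>

lemma compatible_metric_continuous:
  assumes "compatible_metric Y d"
  shows "continuous_on (Y \<times> Y) (\<lambda>p. d (fst p) (snd p))"
proof -
  interpret Metric_space Y d using assms by (simp add: compatible_metric_def)
  have top: "mtopology = top_of_set Y" using assms by (simp add: compatible_metric_def)
  have "continuous_map (top_of_set (Y \<times> Y)) euclidean (\<lambda>p. mdist (metric (Y, d)) (fst p) (snd p))"
    by (intro continuous_map_mdist)
       (auto simp: top continuous_map_in_subtopology continuous_on_fst continuous_on_snd)
  then show ?thesis by simp
qed

text \<open>On the compact set of pairs whose images are at least \<epsilon> apart, \<open>d\<close>
  attains a minimum. Such pairs are distinct, so the minimum is positive and serves as
  \<eta>.\<close>

lemma compatible_metric_uniformly_continuous:
  fixes h :: "'a::topological_space \<Rightarrow> 'b::metric_space"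
  assumes d: "compatible_metric Y d" and Y: "compact Y" and h: "continuous_on Y h" and "\<epsilon> > 0"
  obtains \<eta> where "\<eta> > 0" "\<And>y y'. \<lbrakk>y \<in> Y; y' \<in> Y; d y y' < \<eta>\<rbrakk> \<Longrightarrow> dist (h y) (h y') < \<epsilon>"
proof -
  let ?K = "{p \<in> Y \<times> Y. dist (h (fst p)) (h (snd p)) \<in> {\<epsilon>..}}"
  interpret Metric_space Y d using d by (simp add: compatible_metric_def)
  have "continuous_on (Y \<times> Y) (\<lambda>p. dist (h (fst p)) (h (snd p)))"
    by (intro continuous_on_dist continuous_on_compose2[OF h] continuous_on_fst continuous_on_snd) auto
  then have "closedin (top_of_set (Y \<times> Y)) ?K"
    using continuous_closedin_preimage[of "Y \<times> Y" _ "{\<epsilon>..}"] by (simp add: vimage_def Collect_conj_eq)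
  then have K: "compact ?K" using closedin_compact compact_Times Y by blast
  show ?thesis
  proof (cases "?K = {}")
    case True
    then show ?thesis by (intro that[of 1]) fastforce+
  next
    case False
    then obtain q where q: "q \<in> ?K" "\<And>p. p \<in> ?K \<Longrightarrow> d (fst q) (snd q) \<le> d (fst p) (snd p)"
      using continuous_attains_inf[OF K False
          continuous_on_subset[OF compatible_metric_continuous[OF d]]] by auto
    have "fst q \<noteq> snd q" using q(1) \<open>\<epsilon> > 0\<close> by auto
    then have "d (fst q) (snd q) > 0" using q(1) by (auto simp: mdist_pos_less)
    moreover have "dist (h y) (h y') < \<epsilon>" if "y \<in> Y" "y' \<in> Y" "d y y' < d (fst q) (snd q)" for y y'
      using q(2)[of "(y, y')"] that by fastforce
    ultimately show ?thesis using that by blast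
  qed
qed

text \<open>Whatever the compatible metric, agreement in finitely many coordinates forces closeness.
  Having them all on one level \<open>N\<close> lets the shadowing argument take place in a single
  shift of finite type.\<close>

lemma compatible_metric_depth:
  assumes d: "compatible_metric (inverse_limit X g) d" and comp: "compact (inverse_limit X g)" and "\<eta> > 0"
  obtains N M :: nat where "\<And>y y'. \<lbrakk>y \<in> inverse_limit X g; y' \<in> inverse_limit X g;
      \<And>i. i \<le> M \<Longrightarrow> y N i = (y' N i :: nat)\<rbrakk> \<Longrightarrow> d y y' < \<eta>"
proof -
  let ?Y = "inverse_limit X g"
  let ?K = "{p \<in> ?Y \<times> ?Y. d (fst p) (snd p) \<in> {\<eta>..}}"
  interpret Metric_space ?Y d using d by (simp add: compatible_metric_def)
  have "closedin (top_of_set (?Y \<times> ?Y)) ?K"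
    using continuous_closedin_preimage[OF compatible_metric_continuous[OF d], of "{\<eta>..}"]
    by (simp add: vimage_def Collect_conj_eq)
  then have K: "compact ?K" using closedin_compact compact_Times comp by blast
  txt \<open>The compact set of pairs at distance at least \<open>\<eta>\<close> is covered twice: first to bound the level at
    which the points differ by some \<open>N\<close>, so that they differ at level \<open>N\<close> itself, then to bound the depth.\<close>
  define U where "U = (\<lambda>(n, i). {p :: (nat \<Rightarrow> nat \<Rightarrow> nat) \<times> (nat \<Rightarrow> nat \<Rightarrow> nat). fst p n i \<noteq> snd p n i})"
  have U: "open (U c)" for c
  proof -
    obtain n i where c: "c = (n, i)" by (cases c)
    have "continuous_on UNIV (\<lambda>p::(nat \<Rightarrow> nat \<Rightarrow> nat) \<times> (nat \<Rightarrow> nat \<Rightarrow> nat). fst p n i \<noteq> snd p n i)"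
      by (rule continuous_on_discrete2;
          rule continuous_on_compose2[OF continuous_on_coordinate2[of UNIV]])
         (auto intro: continuous_intros)
    then have "open ((\<lambda>p::(nat \<Rightarrow> nat \<Rightarrow> nat) \<times> (nat \<Rightarrow> nat \<Rightarrow> nat). fst p n i \<noteq> snd p n i) -` {True})"
      by (simp add: continuous_on_open_vimage open_discrete)
    then show ?thesis by (simp add: U_def c vimage_def)
  qed
  have ne: "fst p \<noteq> snd p" if "p \<in> ?K" for p using that \<open>\<eta> > 0\<close> by auto
  have "?K \<subseteq> (\<Union>c\<in>UNIV. U c)"
    using ne by (fastforce simp: U_def fun_eq_iff)
  from compactE_image[OF K U this] obtain C where C: "finite C" "?K \<subseteq> (\<Union>c\<in>C. U c)" .
  obtain N where N: "\<And>c. c \<in> C \<Longrightarrow> fst c \<le> N"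
    using C(1) by (meson finite_imageI finite_nat_set_iff_bounded_le imageI)
  \<comment> \<open>Every level named in \<open>C\<close> is the image of level \<open>N\<close>
    under a bonding map, so points equal at level \<open>N\<close> would agree in all coordinates
    listed in \<open>C\<close>.\<close>
  have neN: "fst p N \<noteq> snd p N" if pK: "p \<in> ?K" for p
  proof
    assume eq: "fst p N = snd p N"
    obtain c where "c \<in> C" "p \<in> U c" using C(2) pK by blast
    then obtain n i where "(n, i) \<in> C" "fst p n i \<noteq> snd p n i" by (cases c) (auto simp: U_def)
    moreover have "y n = g n N (y N)" if "y \<in> ?Y" for y
      using N[of "(n, i)"] that \<open>(n, i) \<in> C\<close> unfolding inverse_limit_def by auto
    then have "fst p n = g n N (fst p N)" "snd p n = g n N (snd p N)" using pK by auto
    ultimately show False using eq by simp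
  qed
  have "?K \<subseteq> (\<Union>i\<in>UNIV. U (N, i))"
  proof
    fix p assume "p \<in> ?K"
    from neN[OF this] obtain i where "fst p N i \<noteq> snd p N i" by blast
    then show "p \<in> (\<Union>i\<in>UNIV. U (N, i))" by (auto simp: U_def)
  qed
  from compactE_image[OF K U this]
  obtain C' where C': "finite C'" "?K \<subseteq> (\<Union>i\<in>C'. U (N, i))" .
  obtain M where M: "\<And>i. i \<in> C' \<Longrightarrow> i \<le> M"
    using C'(1) by (meson finite_nat_set_iff_bounded_le)
  show ?thesis
  proof (rule that[of M N], rule ccontr)
    fix y y' assume *: "y \<in> ?Y" "y' \<in> ?Y" "\<And>i. i \<le> M \<Longrightarrow> y N i = y' N i" "\<not> d y y' < \<eta>"
    then have "(y, y') \<in> ?K" by simp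
    then obtain i where "i \<in> C'" "(y, y') \<in> U (N, i)" using C'(2) by blast
    then show False using M *(3) by (simp add: U_def)
  qed
qed

section \<open>Shadowing in inverse limits and factors\<close>

lemma shift_star_apply: "shift_star y n = shift_map (y n)"
  by (simp add: shift_star_def induced_map_def)

lemma inverse_limitD:
  assumes "y \<in> inverse_limit X g"
  shows "y n \<in> X n" and "n \<le> m \<Longrightarrow> y n = g n m (y m)"
  using assms unfolding inverse_limit_def by blast+

lemma shift_star_inverse_limit:
  assumes "inverse_sequence (\<lambda>n. shift_map) Z g" "y \<in> inverse_limit Z g"
  shows "shift_star y \<in> inverse_limit Z g"
proof -
  note y = inverse_limitD[OF assms(2)]
  have "shift_star y n \<in> Z n" for n
    using inverse_sequenceD(7)[OF assms(1)] y(1) by (auto simp: shift_star_apply)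
  moreover have "shift_star y n = g n m (shift_star y m)" if "n \<le> m" for n m
    using inverse_sequenceD(6)[OF assms(1) that y(1)] y(2)[OF that] by (simp add: shift_star_apply)
  ultimately show ?thesis by (simp add: inverse_limit_def)
qed

text \<open>Closeness in \<open>d\<close> is turned into agreement of finitely many letters at one
  level. There \<open>sft_shadowing\<close> traces these letters exactly, and
  \<open>compatible_metric_depth\<close> turns agreement back into closeness.\<close>

lemma inverse_limit_has_shadowing:
  assumes Z: "sft_inverse_sequence Z g" and d: "compatible_metric (inverse_limit Z g) d"
  shows "has_shadowing shift_star (inverse_limit Z g) d"
  unfolding has_shadowing_def
proof (intro allI impI)
  fix \<epsilon> :: real assume "\<epsilon> > 0"
  let ?Y = "inverse_limit Z g"
  have inv: "inverse_sequence (\<lambda>n. shift_map) Z g" using Z by (simp add: sft_inverse_sequence_def)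
  note comp = compact_inverse_limit[OF inv]
  obtain N M where NM: "\<And>y y'. \<lbrakk>y \<in> ?Y; y' \<in> ?Y; \<And>i. i \<le> M \<Longrightarrow> y N i = y' N i\<rbrakk> \<Longrightarrow> d y y' < \<epsilon>"
    using compatible_metric_depth[OF d comp \<open>\<epsilon> > 0\<close>] by metis
  obtain \<Sigma> where "sft_over \<Sigma> (Z N)" using Z by (auto simp: sft_inverse_sequence_def)
  from sft_shadowing[OF this] obtain L where L:
    "\<And>M x. \<lbrakk>L \<le> M; \<And>j. x j \<in> Z N; \<And>i j. i \<le> M \<Longrightarrow> x (Suc j) i = x j (Suc i)\<rbrakk>
      \<Longrightarrow> \<exists>z\<in>Z N. \<forall>j. \<forall>i\<le>M. (shift_map ^^ j) z i = x j i" by metis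
  \<comment> \<open>\<open>L\<close> is what tracing in \<open>Z N\<close> requires,
    \<open>M\<close> what closeness within \<epsilon> requires.\<close>
  define K where "K = max L M"
  have "\<exists>\<eta>>0. \<forall>y\<in>?Y. \<forall>y'\<in>?Y. d y y' < \<eta> \<longrightarrow> y N i = y' N i" for i
  proof -
    \<comment> \<open>The coordinate takes natural values, so two values less than 1 apart
      coincide.\<close>
    have "continuous_on ?Y (\<lambda>y. real (y N i))"
      by (rule continuous_on_discrete1[OF continuous_on_coordinate2])
    from compatible_metric_uniformly_continuous[OF d comp this zero_less_one]
    obtain \<eta> where "\<eta> > 0" and
      \<eta>: "\<And>y y'. \<lbrakk>y \<in> ?Y; y' \<in> ?Y; d y y' < \<eta>\<rbrakk> \<Longrightarrow> dist (real (y N i)) (real (y' N i)) < 1" by metis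
    then show ?thesis by (intro exI[of _ \<eta>]) (fastforce simp: dist_real_def)
  qed
  then obtain r where r: "\<And>i. r i > (0::real)"
    "\<And>i y y'. \<lbrakk>y \<in> ?Y; y' \<in> ?Y; d y y' < r i\<rbrakk> \<Longrightarrow> y N i = y' N i" by metis
  define \<eta> where "\<eta> = Min (r ` {..K})"
  have "\<eta> > 0" and \<eta>: "\<And>i. i \<le> K \<Longrightarrow> \<eta> \<le> r i" by (auto simp: \<eta>_def r(1))
  have "\<exists>y\<in>?Y. shadows shift_star d \<epsilon> y x" if x: "pseudo_orbit shift_star ?Y d \<eta> x" for x
  proof -
    have xY: "x j \<in> ?Y" and xd: "d (x (Suc j)) (shift_star (x j)) < \<eta>" for j
      using x by (auto simp: pseudo_orbit_def)
    have "x (Suc j) N i = x j N (Suc i)" if "i \<le> K" for i j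
    proof -
      have "d (x (Suc j)) (shift_star (x j)) < r i" using xd[of j] \<eta>[OF that] by linarith
      then have "x (Suc j) N i = shift_star (x j) N i"
        by (rule r(2)[OF xY shift_star_inverse_limit[OF inv xY]])
      then show ?thesis by (simp add: shift_star_apply shift_map_def)
    qed
    moreover have "x j N \<in> Z N" for j using xY by (simp add: inverse_limit_def)
    ultimately obtain z where z: "z \<in> Z N" "\<And>i j. i \<le> K \<Longrightarrow> (shift_map ^^ j) z i = x j N i"
      using L[of K "\<lambda>j. x j N"] unfolding K_def by auto
    obtain y where y: "y \<in> ?Y" "y N = z" using inverse_limit_projection_surj[OF inv z(1)] .
    have yN: "(shift_star ^^ j) y N = (shift_map ^^ j) z" for j
      by (induction j) (simp_all add: y shift_star_apply)
    have yY: "(shift_star ^^ j) y \<in> ?Y" for j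
      by (induction j) (simp_all add: y shift_star_inverse_limit[OF inv])
    have "d (x j) ((shift_star ^^ j) y) < \<epsilon>" for j
      by (rule NM[OF xY yY]) (simp add: yN z(2) K_def)
    then show ?thesis using y(1) by (auto simp: shadows_def)
  qed
  then show "\<exists>\<delta>>0. \<forall>x. pseudo_orbit shift_star ?Y d \<delta> x \<longrightarrow> (\<exists>z\<in>?Y. shadows shift_star d \<epsilon> z x)"
    using \<open>\<eta> > 0\<close> by blast
qed

section \<open>Semiconjugacies, shadowing and lifting\<close>

lemma semiconjugacy_funpow:
  assumes "semiconjugacy g Y f X \<phi>" "g ` Y \<subseteq> Y" "y \<in> Y"
  shows "(g ^^ i) y \<in> Y" "\<phi> ((g ^^ i) y) = (f ^^ i) (\<phi> y)"
proof -
  show *: "(g ^^ i) y \<in> Y" for i using assms by (induction i) auto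
  show "\<phi> ((g ^^ i) y) = (f ^^ i) (\<phi> y)"
    using assms * by (induction i) (auto simp: semiconjugacy_def)
qed

text \<open>Lift the pseudo-orbit approximately, shadow the lift in \<open>Y\<close>, and push the
  shadowing point down. Half of \<epsilon> pays for the lift, the other half for the shadowing error
  seen through the uniformly continuous \<open>\<phi>\<close>.\<close>

lemma has_shadowing_factor:
  fixes f :: "'a::metric_space \<Rightarrow> 'a"
  assumes semi: "semiconjugacy g Y f X \<phi>" and g: "g ` Y \<subseteq> Y"
    and d: "compatible_metric Y d" and Y: "compact Y"
    and sh: "has_shadowing g Y d" and alp: "almost_lifts_pseudo_orbits g Y d f X dist \<phi>"
  shows "has_shadowing f X dist"
  unfolding has_shadowing_def
proof (intro allI impI)
  fix \<epsilon> :: real assume "\<epsilon> > 0"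
  then have "\<epsilon> / 2 > 0" by simp
  have "continuous_on Y \<phi>" using semi by (simp add: semiconjugacy_def)
  from compatible_metric_uniformly_continuous[OF d Y this \<open>\<epsilon> / 2 > 0\<close>]
  obtain \<theta> where "\<theta> > 0" and
    \<theta>: "\<And>y y'. \<lbrakk>y \<in> Y; y' \<in> Y; d y y' < \<theta>\<rbrakk> \<Longrightarrow> dist (\<phi> y) (\<phi> y') < \<epsilon> / 2" by metis
  obtain \<eta> where "\<eta> > 0" and \<eta>: "\<And>y. pseudo_orbit g Y d \<eta> y \<Longrightarrow> \<exists>z\<in>Y. shadows g d \<theta> z y"
    using sh \<open>\<theta> > 0\<close> unfolding has_shadowing_def by metis
  obtain \<delta> where "\<delta> > 0" and \<delta>: "\<And>x. pseudo_orbit f X dist \<delta> x \<Longrightarrow>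
      \<exists>y. pseudo_orbit g Y d \<eta> y \<and> (\<forall>i. dist (\<phi> (y i)) (x i) < \<epsilon> / 2)"
    using alp \<open>\<eta> > 0\<close> \<open>\<epsilon> / 2 > 0\<close> unfolding almost_lifts_pseudo_orbits_def by metis
  have "\<exists>z\<in>X. shadows f dist \<epsilon> z x" if "pseudo_orbit f X dist \<delta> x" for x
  proof -
    obtain y where y: "pseudo_orbit g Y d \<eta> y" "\<And>i. dist (\<phi> (y i)) (x i) < \<epsilon> / 2"
      using \<delta>[OF \<open>pseudo_orbit f X dist \<delta> x\<close>] by metis
    obtain z where z: "z \<in> Y" "\<And>i. d (y i) ((g ^^ i) z) < \<theta>"
      using \<eta>[OF y(1)] by (auto simp: shadows_def)
    have "dist (x i) ((f ^^ i) (\<phi> z)) < \<epsilon>" for i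
    proof -
      have "dist (\<phi> (y i)) ((f ^^ i) (\<phi> z)) < \<epsilon> / 2"
        using \<theta>[OF _ semiconjugacy_funpow(1)[OF semi g z(1)] z(2)[of i]] y(1)
        by (simp add: semiconjugacy_funpow(2)[OF semi g z(1)] pseudo_orbit_def)
      then show ?thesis using y(2)[of i] dist_triangle_half_r by blast
    qed
    moreover have "\<phi> z \<in> X" using semi z(1) by (auto simp: semiconjugacy_def)
    ultimately show ?thesis by (auto simp: shadows_def)
  qed
  then show "\<exists>\<delta>>0. \<forall>x. pseudo_orbit f X dist \<delta> x \<longrightarrow> (\<exists>z\<in>X. shadows f dist \<epsilon> z x)"
    using \<open>\<delta> > 0\<close> by blast
qed

text \<open>The orbit of a preimage of the shadowing point is a pseudo-orbit for every \<eta>, so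
  \<delta> is chosen from \<epsilon> alone.\<close>

lemma has_shadowing_imp_ALP:
  fixes f :: "'a::metric_space \<Rightarrow> 'a"
  assumes sh: "has_shadowing f X dist" and semi: "semiconjugacy g Y f X \<phi>"
    and g: "g ` Y \<subseteq> Y" and "Metric_space Y d"
  shows "almost_lifts_pseudo_orbits g Y d f X dist \<phi>"
  unfolding almost_lifts_pseudo_orbits_def
proof (intro allI impI)
  fix \<epsilon> \<eta> :: real assume "\<epsilon> > 0" "\<eta> > 0"
  interpret Metric_space Y d by fact
  obtain \<delta> where "\<delta> > 0" and \<delta>: "\<And>x. pseudo_orbit f X dist \<delta> x \<Longrightarrow> \<exists>z\<in>X. shadows f dist \<epsilon> z x"
    using sh \<open>\<epsilon> > 0\<close> unfolding has_shadowing_def by metis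
  have "\<exists>y. pseudo_orbit g Y d \<eta> y \<and> (\<forall>i. dist (\<phi> (y i)) (x i) < \<epsilon>)"
    if "pseudo_orbit f X dist \<delta> x" for x
  proof -
    obtain z where "z \<in> X" and z: "shadows f dist \<epsilon> z x" using \<delta>[OF \<open>pseudo_orbit f X dist \<delta> x\<close>] by blast
    then obtain w where w: "w \<in> Y" "\<phi> w = z" using semi by (auto simp: semiconjugacy_def)
    note orb = semiconjugacy_funpow[OF semi g w(1)]
    \<comment> \<open>Membership in \<open>Y\<close> is what makes the \<open>d\<close>-distance of
      this point to itself zero.\<close>
    have "(g ^^ Suc i) w \<in> Y" for i by (rule orb(1))
    then have "pseudo_orbit g Y d \<eta> (\<lambda>i. (g ^^ i) w)"
      using orb(1) \<open>\<eta> > 0\<close> by (simp add: pseudo_orbit_def)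
    moreover have "dist (\<phi> ((g ^^ i) w)) (x i) < \<epsilon>" for i
      using z by (simp add: orb(2) w(2) shadows_def dist_commute)
    ultimately show ?thesis by blast
  qed
  then show "\<exists>\<delta>>0. \<forall>x. pseudo_orbit f X dist \<delta> x \<longrightarrow>
      (\<exists>y. pseudo_orbit g Y d \<eta> y \<and> (\<forall>i. dist (\<phi> (y i)) (x i) < \<epsilon>))"
    using \<open>\<delta> > 0\<close> by blast
qed

section \<open>Stacks of pseudo-orbits\<close>

text \<open>The net is given by indices because alphabets consist of natural numbers;
  \<open>e\<close> names the points. The bound \<open>\<delta> \<le> \<epsilon>\<close> makes
  one-step errors vanish along finer and finer nets.\<close>

definition shadowing_net ::
    "('a::metric_space \<Rightarrow> 'a) \<Rightarrow> 'a set \<Rightarrow> real \<Rightarrow> nat set \<Rightarrow> (nat \<Rightarrow> 'a) \<Rightarrow> real \<Rightarrow> bool" where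
  "shadowing_net f X \<epsilon> I e \<delta> \<longleftrightarrow> finite I \<and> e ` I \<subseteq> X \<and> \<delta> \<le> \<epsilon> \<and>
     (\<forall>x. pseudo_orbit f X dist \<delta> x \<longrightarrow> (\<exists>z\<in>X. shadows f dist \<epsilon> z x)) \<and>
     (\<forall>z\<in>X. \<exists>p. range p \<subseteq> I \<and> pseudo_orbit f X dist \<delta> (e \<circ> p) \<and> shadows f dist \<epsilon> z (e \<circ> p))"

text \<open>Each orbit point is replaced by a net point within \<open>a\<close>. In one step of the
  new sequence, moving the starting point and moving the end point each cost less than
  \<open>\<delta> / 2\<close>.\<close>

lemma shadowing_net_exists:
  fixes X :: "'a::metric_space set"
  assumes X: "compact X" and f: "dynamical_system f X" and sh: "has_shadowing f X dist" and "\<epsilon> > 0"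
  shows "\<exists>I e \<delta>. shadowing_net f X \<epsilon> I e \<delta>"
proof -
  obtain \<delta>' where "\<delta>' > 0" and \<delta>': "\<And>x. pseudo_orbit f X dist \<delta>' x \<Longrightarrow> \<exists>z\<in>X. shadows f dist \<epsilon> z x"
    using sh \<open>\<epsilon> > 0\<close> unfolding has_shadowing_def by metis
  define \<delta> where "\<delta> = min \<delta>' \<epsilon>"
  have \<delta>: "\<delta> > 0" "\<delta> \<le> \<delta>'" "\<delta> \<le> \<epsilon>" using \<open>\<delta>' > 0\<close> \<open>\<epsilon> > 0\<close> by (auto simp: \<delta>_def)
  have fc: "continuous_on X f" and fX: "f ` X \<subseteq> X" using f by (auto simp: dynamical_system_def)
  have "uniformly_continuous_on X f" by (rule compact_uniformly_continuous[OF fc X])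
  then obtain b where "b > 0" and b: "\<And>u v. \<lbrakk>u \<in> X; v \<in> X; dist v u < b\<rbrakk> \<Longrightarrow> dist (f v) (f u) < \<delta> / 2"
    unfolding uniformly_continuous_on_def using \<delta>(1) by (meson half_gt_zero)
  \<comment> \<open>The bound \<open>b\<close> controls images under \<open>f\<close>; the bound
    \<open>\<delta> / 2\<close> controls end points and also keeps the tracing within
    \<epsilon>.\<close>
  define a where "a = min b (\<delta> / 2)"
  have a: "a > 0" "a \<le> b" "a \<le> \<delta> / 2" using \<open>b > 0\<close> \<delta>(1) by (auto simp: a_def)
  obtain k where k: "finite k" "k \<subseteq> X" "X \<subseteq> (\<Union>x\<in>k. ball x a)"
    using seq_compact_imp_totally_bounded[of X] X a(1) by (auto simp: compact_eq_seq_compact_metric)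
  obtain n :: nat and e where e: "k = e ` {i. i < n}"
    using finite_imp_nat_seg_image_inj_on[OF k(1)] by blast
  let ?I = "{i. i < n}"
  have "shadowing_net f X \<epsilon> ?I e \<delta>"
    unfolding shadowing_net_def
  proof (intro conjI allI ballI impI)
    show "\<exists>z\<in>X. shadows f dist \<epsilon> z x" if "pseudo_orbit f X dist \<delta> x" for x
      using that \<delta>(2) by (intro \<delta>') (auto simp: pseudo_orbit_def intro: less_le_trans)
    fix z assume "z \<in> X"
    have orb: "(f ^^ i) z \<in> X" for i using \<open>z \<in> X\<close> fX by (induction i) auto
    have "\<exists>j\<in>?I. dist (e j) ((f ^^ i) z) < a" for i
      using k(3) orb[of i] unfolding e by (auto simp: subset_iff)
    then obtain p where p: "\<And>i. p i \<in> ?I" "\<And>i. dist (e (p i)) ((f ^^ i) z) < a" by metis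
    have pX: "e (p i) \<in> X" for i using p(1) k(2) e by blast
    have "dist (e (p (Suc i))) (f (e (p i))) < \<delta>" for i
    proof -
      have "dist (f (e (p i))) (f ((f ^^ i) z)) < \<delta> / 2"
        by (rule b[OF orb pX]) (use p(2)[of i] a(2) in linarith)
      moreover have "dist (e (p (Suc i))) (f ((f ^^ i) z)) < \<delta> / 2"
        using p(2)[of "Suc i"] a(3) by simp
      ultimately show ?thesis using dist_triangle_half_l by blast
    qed
    then have "pseudo_orbit f X dist \<delta> (e \<circ> p)" using pX by (simp add: pseudo_orbit_def)
    moreover have "shadows f dist \<epsilon> z (e \<circ> p)"
      unfolding shadows_def comp_def
    proof
      show "dist (e (p i)) ((f ^^ i) z) < \<epsilon>" for i using p(2)[of i] a(3) \<delta> by linarith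
    qed
    ultimately show "\<exists>p. range p \<subseteq> ?I \<and> pseudo_orbit f X dist \<delta> (e \<circ> p) \<and> shadows f dist \<epsilon> z (e \<circ> p)"
      using p(1) by blast
  qed (use k(2) e \<delta>(3) in auto)
  then show ?thesis by blast
qed

section \<open>The inverse sequence of stacks over nets at scales \<open>(1/2) ^ n\<close>\<close>

locale shadowing_nets =
  fixes X :: "'a::metric_space set" and f :: "'a \<Rightarrow> 'a"
    and I :: "nat \<Rightarrow> nat set" and e :: "nat \<Rightarrow> nat \<Rightarrow> 'a" and \<delta> :: "nat \<Rightarrow> real"
  assumes compact_X: "compact X" and dyn: "dynamical_system f X"
    and net: "shadowing_net f X ((1/2) ^ n) (I n) (e n) (\<delta> n)"
begin

lemma finite_I: "finite (I n)" and net_subset: "e n ` I n \<subseteq> X" and \<delta>_le: "\<delta> n \<le> (1/2) ^ n"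
  and shadowing: "pseudo_orbit f X dist (\<delta> n) x \<Longrightarrow> \<exists>z\<in>X. shadows f dist ((1/2) ^ n) z x"
  and tracing: "z \<in> X \<Longrightarrow> \<exists>p. range p \<subseteq> I n \<and> pseudo_orbit f X dist (\<delta> n) (e n \<circ> p) \<and>
    shadows f dist ((1/2) ^ n) z (e n \<circ> p)"
  using net[of n] by (simp_all add: shadowing_net_def)

text \<open>
  A letter of level \<open>n\<close> is the code of a list \<open>[i\<^sub>0, \<dots>, i\<^sub>n]\<close> of indices: one column of a stack,
  standing for the points \<open>e k i\<^sub>k\<close>.
\<close>

definition digit :: "nat \<Rightarrow> nat \<Rightarrow> nat" where
  "digit k c = list_decode c ! k"

definition pt :: "nat \<Rightarrow> nat \<Rightarrow> 'a" where
  "pt k c = e k (digit k c)"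

text \<open>Closeness of consecutive rows is imposed inside a letter, so that only
  \<open>step\<close> relates neighbouring letters. Points of rows \<open>k\<close> and
  \<open>Suc k\<close> that follow a common orbit within \<open>(1/2) ^ k\<close> and
  \<open>(1/2) ^ Suc k\<close> meet the bound, and the bounds are summable.\<close>

definition letter :: "nat \<Rightarrow> nat \<Rightarrow> bool" where
  "letter n c \<longleftrightarrow> length (list_decode c) = Suc n \<and> (\<forall>k\<le>n. digit k c \<in> I k) \<and>
     (\<forall>k<n. dist (pt k c) (pt (Suc k) c) < 2 * (1/2) ^ k)"

definition step :: "nat \<Rightarrow> nat \<Rightarrow> nat \<Rightarrow> bool" where
  "step n c c' \<longleftrightarrow> (\<forall>k\<le>n. dist (pt k c') (f (pt k c)) < \<delta> k)"

definition stacks :: "nat \<Rightarrow> (nat \<Rightarrow> nat) set" where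
  "stacks n = {x. (\<forall>i. x i \<in> {c. letter n c}) \<and> (\<forall>i. step n (x i) (x (Suc i)))}"

definition trunc :: "nat \<Rightarrow> nat \<Rightarrow> nat" where
  "trunc n c = list_encode (take (Suc n) (list_decode c))"

definition bond :: "nat \<Rightarrow> nat \<Rightarrow> (nat \<Rightarrow> nat) \<Rightarrow> nat \<Rightarrow> nat" where
  "bond n m x = (\<lambda>i. trunc n (x i))"

lemma digit_trunc: "k \<le> n \<Longrightarrow> digit k (trunc n c) = digit k c"
  by (simp add: digit_def trunc_def)

lemma pt_trunc: "k \<le> n \<Longrightarrow> pt k (trunc n c) = pt k c"
  by (simp add: pt_def digit_trunc)

lemma trunc_trunc: "n \<le> m \<Longrightarrow> trunc n (trunc m c) = trunc n c"
  by (simp add: trunc_def min_def)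

lemma letter_trunc: "letter m c \<Longrightarrow> n \<le> m \<Longrightarrow> letter n (trunc n c)"
  by (auto simp: letter_def digit_trunc pt_trunc) (simp add: trunc_def)

lemma step_trunc: "step m c c' \<Longrightarrow> n \<le> m \<Longrightarrow> step n (trunc n c) (trunc n c')"
  by (simp add: step_def pt_trunc)

lemma finite_letter: "finite {c. letter n c}"
proof -
  have "{c. letter n c} \<subseteq> list_encode ` {xs. set xs \<subseteq> (\<Union>k\<le>n. I k) \<and> length xs = Suc n}"
  proof
    fix c assume "c \<in> {c. letter n c}"
    then have "set (list_decode c) \<subseteq> (\<Union>k\<le>n. I k)" "length (list_decode c) = Suc n"
      by (force simp: letter_def digit_def in_set_conv_nth less_Suc_eq_le)+
    then show "c \<in> list_encode ` {xs. set xs \<subseteq> (\<Union>k\<le>n. I k) \<and> length xs = Suc n}"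
      by (intro image_eqI[of _ _ "list_decode c"]) auto
  qed
  then show ?thesis
    by (rule finite_subset) (intro finite_imageI finite_lists_length_eq finite_UN_I finite_atMost finite_I)
qed

lemma stacks_sft: "sft_over {c. letter n c} (stacks n)"
  unfolding stacks_def by (rule sft_over_one_step[OF finite_letter])

lemma pt_in_X: "letter n c \<Longrightarrow> k \<le> n \<Longrightarrow> pt k c \<in> X"
  using net_subset[of k] by (auto simp: letter_def pt_def)

lemma bond_mem: "n \<le> m \<Longrightarrow> x \<in> stacks m \<Longrightarrow> bond n m x \<in> stacks n"
  by (auto simp: stacks_def bond_def intro: letter_trunc step_trunc)

text \<open>This is where shadowing of \<open>f\<close> enters. Only the last row of the stack has
  to be followed: the row traced in the next net is tied to it through the shadowing orbit, and the
  earlier rows stay as they are.\<close>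

lemma bond_Suc_surj:
  assumes "x \<in> stacks n"
  shows "\<exists>x'\<in>stacks (Suc n). bond n (Suc n) x' = x"
proof -
  have x: "letter n (x i)" "step n (x i) (x (Suc i))" for i using assms by (auto simp: stacks_def)
  have "pseudo_orbit f X dist (\<delta> n) (\<lambda>i. pt n (x i))"
    using x by (auto simp: pseudo_orbit_def step_def intro: pt_in_X)
  then obtain z where "z \<in> X" and z: "\<And>i. dist (pt n (x i)) ((f ^^ i) z) < (1/2) ^ n"
    using shadowing unfolding shadows_def by blast
  obtain q where q: "range q \<subseteq> I (Suc n)" "pseudo_orbit f X dist (\<delta> (Suc n)) (e (Suc n) \<circ> q)"
    "shadows f dist ((1/2) ^ Suc n) z (e (Suc n) \<circ> q)"
    using tracing[OF \<open>z \<in> X\<close>, of "Suc n"] by blast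
  define x' where "x' i = list_encode (list_decode (x i) @ [q i])" for i
  have len: "length (list_decode (x i)) = Suc n" for i using x(1) by (simp add: letter_def)
  have dg: "digit k (x' i) = (if k = Suc n then q i else digit k (x i))" if "k \<le> Suc n" for k i
    using that len[of i] by (simp add: digit_def x'_def nth_append)
  have pt_old: "pt k (x' i) = pt k (x i)" if "k \<le> n" for k i using that by (simp add: pt_def dg)
  have pt_new: "pt (Suc n) (x' i) = e (Suc n) (q i)" for i by (simp add: pt_def dg)
  \<comment> \<open>Both points are near \<open>(f ^^ i) z\<close>, the old one by shadowing and the
    new one by tracing.\<close>
  have "dist (pt n (x i)) (e (Suc n) (q i)) < 2 * (1/2) ^ n" for i
  proof -
    have "dist (e (Suc n) (q i)) ((f ^^ i) z) < (1/2) ^ Suc n" using q(3) by (simp add: shadows_def)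
    also have "\<dots> \<le> (1/2) ^ n" by simp
    finally show ?thesis using z[of i]
      dist_triangle2[of "pt n (x i)" "e (Suc n) (q i)" "(f ^^ i) z"] by linarith
  qed
  then have near: "dist (pt n (x' i)) (pt (Suc n) (x' i)) < 2 * (1/2) ^ n" for i
    by (simp add: pt_old pt_new)
  have "letter (Suc n) (x' i)" for i
    unfolding letter_def
  proof (intro conjI allI impI)
    show "length (list_decode (x' i)) = Suc (Suc n)" by (simp add: x'_def len)
    show "digit k (x' i) \<in> I k" if "k \<le> Suc n" for k
      using that x(1)[of i] q(1) by (cases "k = Suc n") (auto simp: letter_def dg)
    show "dist (pt k (x' i)) (pt (Suc k) (x' i)) < 2 * (1/2) ^ k" if "k < Suc n" for k
    proof (cases "k = n")
      case False
      then show ?thesis using that x(1)[of i] by (simp add: letter_def pt_old)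
    qed (use near in simp)
  qed
  moreover have "step (Suc n) (x' i) (x' (Suc i))" for i
    unfolding step_def
  proof (intro allI impI)
    fix k assume "k \<le> Suc n"
    then consider "k = Suc n" | "k \<le> n" by linarith
    then show "dist (pt k (x' (Suc i))) (f (pt k (x' i))) < \<delta> k"
    proof cases
      case 1
      then show ?thesis using q(2) by (simp add: pt_new pseudo_orbit_def)
    next
      case 2
      then show ?thesis using x(2)[of i] by (simp add: pt_old step_def)
    qed
  qed
  ultimately have "x' \<in> stacks (Suc n)" by (simp add: stacks_def)
  moreover have "bond n (Suc n) x' = x"
    using len by (simp add: bond_def trunc_def x'_def)
  ultimately show ?thesis by blast
qed

lemma bond_surj:
  assumes "n \<le> m"
  shows "bond n m ` stacks m = stacks n"
proof
  show "bond n m ` stacks m \<subseteq> stacks n" using bond_mem[OF assms] by blast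
  show "stacks n \<subseteq> bond n m ` stacks m"
    using assms
  proof (induction m rule: dec_induct)
    case base
    have "bond n n x = x" if "x \<in> stacks n" for x
      using that by (auto simp: stacks_def bond_def trunc_def letter_def)
    then show ?case by force
  next
    case (step m)
    show ?case
    proof
      fix x assume "x \<in> stacks n"
      then obtain x1 where "x1 \<in> stacks m" "x = bond n m x1" using step.IH by blast
      moreover obtain x2 where "x2 \<in> stacks (Suc m)" "bond m (Suc m) x2 = x1"
        using bond_Suc_surj[OF \<open>x1 \<in> stacks m\<close>] by blast
      ultimately have "x = bond n (Suc m) x2" using step.hyps by (auto simp: bond_def trunc_trunc)
      then show "x \<in> bond n (Suc m) ` stacks (Suc m)" using \<open>x2 \<in> stacks (Suc m)\<close> by blast
    qed
  qed
qed

lemma stacks_inverse_sequence: "sft_inverse_sequence stacks bond"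
  unfolding sft_inverse_sequence_def
proof (intro conjI allI exI)
  show "sft_over {c. letter n c} (stacks n)" for n by (rule stacks_sft)
  have ss: "shift_space {c. letter n c} (stacks n)" for n using stacks_sft by (simp add: sft_over_def)
  have "continuous_on S (shift_map :: (nat \<Rightarrow> nat) \<Rightarrow> _)" for S
    unfolding shift_map_def by (rule continuous_on_coordinatewise_then_product) (rule continuous_on_coordinate)
  moreover have "continuous_on S (bond n m)" for n m S
    unfolding bond_def
    by (rule continuous_on_coordinatewise_then_product)
      (rule continuous_on_discrete1[OF continuous_on_coordinate])
  moreover have "bond n n x = x" if "x \<in> stacks n" for n x
    using that by (auto simp: stacks_def bond_def trunc_def letter_def)
  moreover have "bond n k x = bond n m (bond m k x)" if "n \<le> m" for n m k x
    using that by (simp add: bond_def trunc_trunc)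
  moreover have "shift_map (bond n m x) = bond n m (shift_map x)" for n m x
    by (simp add: bond_def shift_map_def)
  moreover have "compact (stacks n)" "shift_map ` stacks n \<subseteq> stacks n" for n
    using ss[of n] unfolding shift_space_def by blast+
  ultimately show "inverse_sequence (\<lambda>n. shift_map) stacks bond"
    unfolding inverse_sequence_def dynamical_system_def
    by (intro conjI allI impI ballI Hausdorff_space_nat_seq bond_surj)
qed

section \<open>The limit map from stacks onto \<open>X\<close>\<close>

abbreviation "stack_limit \<equiv> inverse_limit stacks bond"

text \<open>Level \<open>k\<close> contributes its last row at time 0; by compatibility with
  truncation, all higher levels carry the same entry in row \<open>k\<close>.\<close>

definition limit_point :: "(nat \<Rightarrow> nat \<Rightarrow> nat) \<Rightarrow> 'a" where
  "limit_point y = lim (\<lambda>k. pt k (y k 0))"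

text \<open>The row gaps \<open>2 * (1/2) ^ n\<close> telescope, each being
  \<open>4 * (1/2) ^ n - 4 * (1/2) ^ Suc n\<close>.\<close>

lemma stack_limit_dist:
  assumes "y \<in> stack_limit"
  shows "dist (pt k (y k i)) (pt (k + j) (y (k + j) i)) \<le> 4 * (1/2) ^ k - 4 * (1/2) ^ (k + j)"
proof (induction j)
  case (Suc j)
  let ?n = "k + j"
  have "letter (Suc ?n) (y (Suc ?n) i)"
    using inverse_limitD(1)[OF assms, of "Suc ?n"] by (simp add: stacks_def)
  \<comment> \<open>Both points can thus be read off the single letter at level
    \<open>Suc ?n\<close>, where the closeness clause of \<open>letter\<close> applies.\<close>
  moreover have "y ?n i = trunc ?n (y (Suc ?n) i)"
    using inverse_limitD(2)[OF assms, of ?n "Suc ?n"] by (simp add: bond_def)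
  then have "pt ?n (y ?n i) = pt ?n (y (Suc ?n) i)" by (simp add: pt_trunc)
  ultimately have "dist (pt ?n (y ?n i)) (pt (Suc ?n) (y (Suc ?n) i)) < 2 * (1/2) ^ ?n"
    by (simp add: letter_def)
  then show ?case
    using Suc dist_triangle[of "pt k (y k i)" "pt (Suc ?n) (y (Suc ?n) i)" "pt ?n (y ?n i)"] by simp
qed simp

lemma stack_limit_in_X: "y \<in> stack_limit \<Longrightarrow> pt k (y k i) \<in> X"
  using inverse_limitD(1)[of y stacks bond k] by (auto simp: stacks_def intro: pt_in_X[of k])

lemma stack_limit_converges:
  assumes "y \<in> stack_limit"
  shows "\<exists>l\<in>X. (\<lambda>k. pt k (y k i)) \<longlonglongrightarrow> l \<and> (\<forall>k. dist (pt k (y k i)) l \<le> 4 * (1/2) ^ k)"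
proof -
  let ?p = "\<lambda>k. pt k (y k i)"
  have near: "dist (?p k) (?p n) \<le> 4 * (1/2) ^ k" if "k \<le> n" for k n
  proof -
    have "dist (?p k) (?p n) \<le> 4 * (1/2) ^ k - 4 * (1/2) ^ n"
      using stack_limit_dist[OF assms, of k i "n - k"] that by simp
    also have "\<dots> \<le> 4 * (1/2) ^ k" by simp
    finally show ?thesis .
  qed
  have "Cauchy ?p"
  proof (rule metric_CauchyI)
    fix r :: real assume "r > 0"
    \<comment> \<open>With \<open>r / 8\<close>, each of the two distances to \<open>?p k\<close> is
      below \<open>r / 2\<close>.\<close>
    then obtain k where k: "(1/2) ^ k < r / 8" using real_arch_pow_inv[of "r / 8" "1/2"] by auto
    have "dist (?p m) (?p n) < r" if "k \<le> m" "k \<le> n" for m n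
      using near[OF that(1)] near[OF that(2)] k dist_triangle3[of "?p m" "?p n" "?p k"] by linarith
    then show "\<exists>M. \<forall>m\<ge>M. \<forall>n\<ge>M. dist (?p m) (?p n) < r" by blast
  qed
  moreover have "\<forall>k. ?p k \<in> X" using stack_limit_in_X[OF assms] by simp
  ultimately obtain l where l: "l \<in> X" "?p \<longlonglongrightarrow> l"
    using completeE[OF compact_imp_complete[OF compact_X], of ?p] by metis
  moreover have "dist (?p k) l \<le> 4 * (1/2) ^ k" for k
    by (rule LIMSEQ_le_const2[OF tendsto_dist[OF tendsto_const l(2)]]) (use near in blast)
  ultimately show ?thesis by blast
qed

lemma limit_point:
  assumes "y \<in> stack_limit"
  shows "limit_point y \<in> X" and "(\<lambda>k. pt k (y k 0)) \<longlonglongrightarrow> limit_point y"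
    and "dist (pt k (y k 0)) (limit_point y) \<le> 4 * (1/2) ^ k"
proof -
  obtain l where l: "l \<in> X" "(\<lambda>k. pt k (y k 0)) \<longlonglongrightarrow> l" "\<And>k. dist (pt k (y k 0)) l \<le> 4 * (1/2) ^ k"
    using stack_limit_converges[OF assms, of 0] by blast
  have "limit_point y = l" unfolding limit_point_def by (rule limI[OF l(2)])
  then show "limit_point y \<in> X" "(\<lambda>k. pt k (y k 0)) \<longlonglongrightarrow> limit_point y"
    "dist (pt k (y k 0)) (limit_point y) \<le> 4 * (1/2) ^ k" using l by simp_all
qed

text \<open>Continuity: the map is a uniform limit of functions of one discrete coordinate.
  Equivariance: row \<open>k\<close> errs by less than \<open>\<delta> k\<close>, which tends to 0.
  Surjectivity: tracings of one orbit in all the nets fit together into a stack.\<close>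

lemma limit_point_semiconjugacy: "semiconjugacy shift_star stack_limit f X limit_point"
  unfolding semiconjugacy_def
proof (intro conjI ballI)
  show "continuous_on stack_limit limit_point"
  proof (rule uniform_limit_theorem)
    show "\<forall>\<^sub>F k in sequentially. continuous_on stack_limit (\<lambda>y. pt k (y k 0))"
      by (intro always_eventually allI) (rule continuous_on_discrete1[OF continuous_on_coordinate2])
    show "uniform_limit stack_limit (\<lambda>k y. pt k (y k 0)) limit_point sequentially"
    proof (rule uniform_limitI)
      fix r :: real assume "r > 0"
      have "(\<lambda>k. 4 * (1/2 :: real) ^ k) \<longlonglongrightarrow> 0"
        by (rule tendsto_mult_right_zero[OF LIMSEQ_power_zero]) simp
      from order_tendstoD(2)[OF this \<open>r > 0\<close>]
      have "\<forall>\<^sub>F k in sequentially. 4 * (1/2 :: real) ^ k < r" .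
      then show "\<forall>\<^sub>F k in sequentially. \<forall>y\<in>stack_limit. dist (pt k (y k 0)) (limit_point y) < r"
      proof (rule eventually_mono, intro ballI)
        show "dist (pt k (y k 0)) (limit_point y) < r"
          if "4 * (1/2 :: real) ^ k < r" "y \<in> stack_limit" for k y
          using limit_point(3)[OF that(2), of k] that(1) by linarith
      qed
    qed
  qed simp
  show "limit_point (shift_star y) = f (limit_point y)" if y: "y \<in> stack_limit" for y
  proof -
    let ?u = "\<lambda>k. pt k (y k 0)" and ?v = "\<lambda>k. pt k (y k 1)"
    have "inverse_sequence (\<lambda>n. shift_map) stacks bond"
      using stacks_inverse_sequence by (simp add: sft_inverse_sequence_def)
    from limit_point(2)[OF shift_star_inverse_limit[OF this y]]
    have v: "?v \<longlonglongrightarrow> limit_point (shift_star y)" by (simp add: shift_star_apply shift_map_def)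
    have "continuous_on X f" using dyn by (simp add: dynamical_system_def)
    then have fu: "(\<lambda>k. f (?u k)) \<longlonglongrightarrow> f (limit_point y)"
      by (rule continuous_on_tendsto_compose[OF _ limit_point(2,1)[OF y]]) (simp add: stack_limit_in_X[OF y])
    \<comment> \<open>The shift moves time 1 to time 0, so \<open>?v\<close> and \<open>?u\<close>
      are joined by one step of each row.\<close>
    have le: "dist (?v k) (f (?u k)) \<le> (1/2) ^ k" for k
    proof -
      have "step k (y k 0) (y k (Suc 0))" using inverse_limitD(1)[OF y, of k] by (simp add: stacks_def)
      then show ?thesis using \<delta>_le[of k] by (force simp: step_def)
    qed
    have "(\<lambda>k. (1/2 :: real) ^ k) \<longlonglongrightarrow> 0" by (rule LIMSEQ_power_zero) simp
    from LIMSEQ_le[OF tendsto_dist[OF v fu] this]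
    have "dist (limit_point (shift_star y)) (f (limit_point y)) \<le> 0" using le by blast
    then show ?thesis by simp
  qed
  show "limit_point ` stack_limit = X"
  proof
    show "limit_point ` stack_limit \<subseteq> X" using limit_point(1) by blast
    show "X \<subseteq> limit_point ` stack_limit"
    proof
      fix z assume "z \<in> X"
      then have "\<forall>n. \<exists>p. range p \<subseteq> I n \<and> pseudo_orbit f X dist (\<delta> n) (e n \<circ> p) \<and>
          shadows f dist ((1/2) ^ n) z (e n \<circ> p)" using tracing by blast
      from choice[OF this] obtain p where
        p: "range (p n) \<subseteq> I n" "pseudo_orbit f X dist (\<delta> n) (e n \<circ> p n)"
          "shadows f dist ((1/2) ^ n) z (e n \<circ> p n)" for n by blast
      \<comment> \<open>The rows are chosen independently of each other; level \<open>n\<close>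
        collects rows 0 to \<open>n\<close>, so truncation to a lower level yields the stack defined
        there.\<close>
      define y where "y n i = list_encode (map (\<lambda>k. p k i) [0..<Suc n])" for n i
      have dg: "digit k (y n i) = p k i" if "k \<le> n" for k n i
        using that by (simp add: digit_def y_def del: upt_Suc)
      have near: "dist (e k (p k i)) ((f ^^ i) z) < (1/2) ^ k" for k i
        using p(3) by (simp add: shadows_def)
      have close: "dist (e k (p k i)) (e (Suc k) (p (Suc k) i)) < 2 * (1/2) ^ k" for k i
      proof -
        have "(1/2 :: real) ^ Suc k \<le> (1/2) ^ k" by simp
        then show ?thesis using near[of k i] near[of "Suc k" i]
          dist_triangle2[of "e k (p k i)" "e (Suc k) (p (Suc k) i)" "(f ^^ i) z"] by linarith
      qed
      have "letter n (y n i)" for n i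
        unfolding letter_def
      proof (intro conjI allI impI)
        show "length (list_decode (y n i)) = Suc n" by (simp add: y_def)
        show "digit k (y n i) \<in> I k" if "k \<le> n" for k using that p(1)[of k] by (auto simp: dg)
        show "dist (pt k (y n i)) (pt (Suc k) (y n i)) < 2 * (1/2) ^ k" if "k < n" for k
          using that close[of k i] by (simp add: pt_def dg)
      qed
      moreover have "step n (y n i) (y n (Suc i))" for n i
        using p(2) by (simp add: step_def pt_def dg pseudo_orbit_def)
      ultimately have "y n \<in> stacks n" for n by (simp add: stacks_def)
      moreover have "y n = bond n m (y m)" if "n \<le> m" for n m
      proof
        show "y n i = bond n m (y m) i" for i
          using that by (simp add: y_def bond_def trunc_def take_map take_upt del: upt_Suc)
      qed
      ultimately have y: "y \<in> stack_limit" unfolding inverse_limit_def by blast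
      have "(\<lambda>k. pt k (y k 0)) \<longlonglongrightarrow> z"
      proof (rule metric_tendsto_imp_tendsto[where a = "0::real"])
        show "(\<lambda>k. (1/2 :: real) ^ k) \<longlonglongrightarrow> 0" by (rule LIMSEQ_power_zero) simp
        show "\<forall>\<^sub>F k in sequentially. dist (pt k (y k 0)) z \<le> dist ((1/2 :: real) ^ k) 0"
          using near[of _ 0] by (intro always_eventually) (simp add: pt_def dg less_imp_le)
      qed
      then have "limit_point y = z" unfolding limit_point_def by (rule limI)
      then show "z \<in> limit_point ` stack_limit" using y by blast
    qed
  qed
qed

end

(* D is an arbitrary choice of a compatible metric on each inverse limit of shifts of finite type. *)
theorem theorem28:
  fixes X :: "'a::metric_space set" and f :: "'a \<Rightarrow> 'a"
    and D :: "(nat \<Rightarrow> (nat \<Rightarrow> nat) set) \<Rightarrow> (nat \<Rightarrow> nat \<Rightarrow> (nat \<Rightarrow> nat) \<Rightarrow> (nat \<Rightarrow> nat)) \<Rightarrow>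
              (nat \<Rightarrow> nat \<Rightarrow> nat) \<Rightarrow> (nat \<Rightarrow> nat \<Rightarrow> nat) \<Rightarrow> real"
  assumes "compact X" and "dynamical_system f X"
    and "\<And>Z g. sft_inverse_sequence Z g \<Longrightarrow> compatible_metric (inverse_limit Z g) (D Z g)"
  shows "has_shadowing f X dist \<longleftrightarrow>
    (\<exists>Z g \<phi>. sft_inverse_sequence Z g \<and>
       semiconjugacy shift_star (inverse_limit Z g) f X \<phi> \<and>
       almost_lifts_pseudo_orbits shift_star (inverse_limit Z g) (D Z g) f X dist \<phi>)"
proof
  have inv: "inverse_sequence (\<lambda>n. shift_map) Z g" if "sft_inverse_sequence Z g" for Z g
    using that by (simp add: sft_inverse_sequence_def)
  have star: "shift_star ` inverse_limit Z g \<subseteq> inverse_limit Z g" if "sft_inverse_sequence Z g" for Z g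
    using shift_star_inverse_limit[OF inv[OF that]] by blast
  {
    assume sh: "has_shadowing f X dist"
    have "\<exists>I e \<delta>. shadowing_net f X ((1/2) ^ n) I e \<delta>" for n
      by (rule shadowing_net_exists[OF assms(1,2) sh]) simp
    \<comment> \<open>The nets at different scales need no coherence; consecutive rows are tied
      together only by the closeness clause of \<open>letter\<close>.\<close>
    then obtain I e \<delta> where "shadowing_net f X ((1/2) ^ n) (I n) (e n) (\<delta> n)" for n by metis
    then interpret shadowing_nets X f I e \<delta>
      by (intro shadowing_nets.intro assms(1,2))
    have "Metric_space stack_limit (D stacks bond)"
      using assms(3)[OF stacks_inverse_sequence] by (simp add: compatible_metric_def)
    then have alp: "almost_lifts_pseudo_orbits shift_star stack_limit (D stacks bond) f X dist limit_point"
      by (rule has_shadowing_imp_ALP[OF sh limit_point_semiconjugacy star[OF stacks_inverse_sequence]])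
    show "\<exists>Z g \<phi>. sft_inverse_sequence Z g \<and>
       semiconjugacy shift_star (inverse_limit Z g) f X \<phi> \<and>
       almost_lifts_pseudo_orbits shift_star (inverse_limit Z g) (D Z g) f X dist \<phi>"
      by (intro exI conjI) (rule stacks_inverse_sequence limit_point_semiconjugacy alp)+
  }
  assume "\<exists>Z g \<phi>. sft_inverse_sequence Z g \<and>
       semiconjugacy shift_star (inverse_limit Z g) f X \<phi> \<and>
       almost_lifts_pseudo_orbits shift_star (inverse_limit Z g) (D Z g) f X dist \<phi>"
  then obtain Z g \<phi> where Z: "sft_inverse_sequence Z g"
    and semi: "semiconjugacy shift_star (inverse_limit Z g) f X \<phi>"
    and alp: "almost_lifts_pseudo_orbits shift_star (inverse_limit Z g) (D Z g) f X dist \<phi>" by blast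
  \<comment> \<open>Compatibility of the metric is used twice: for shadowing in the inverse limit
    and for uniform continuity of \<open>\<phi>\<close>.\<close>
  show "has_shadowing f X dist"
    by (rule has_shadowing_factor[OF semi star[OF Z] assms(3)[OF Z] compact_inverse_limit[OF inv[OF Z]]
        inverse_limit_has_shadowing[OF Z assms(3)[OF Z]] alp])
qed

end
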